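(* Let $(A,[\cdot,\cdot],\alpha,\beta)$ be a regular BiHom-Lie algebra over $\mathbb{K}$, let $(V,[\cdot,\cdot]_V,\rho,\phi,\psi)$ be a regular $A$-module $\mathbb{K}$-algebra, and let $T:V\to A$ be an $\mathcal{O}$-operator of weight $\lambda\in\mathbb{K}$ associated to $(V,[\cdot,\cdot]_V,\rho,\phi,\psi)$. Define two bilinear operations $\{\cdot,\cdot\},\rhd:V\times V\to V$ by $$\{u,v\}=\lambda[u,v]_V,\qquad u\rhd v=\rho(T(u))v,\qquad u,v\in V.$$ Then $(V,\{\cdot,\cdot\},\rhd,\phi,\psi)$ is a BiHom-post-Lie algebra, and $T$ is a morphism of BiHom-Lie algebras from the sub-adjacent BiHom-Lie algebra of $(V,\{\cdot,\cdot\},\rhd,\phi,\psi)$ to $(A,[\cdot,\cdot],\alpha,\beta)$. Furthermore, $T(V)$ is a BiHom-Lie subalgebra of $(A,[\cdot,\cdot],\alpha,\beta)$, and there is an induced BiHom-post-Lie algebra structure on $T(V)$ (with the restrictions of $\alpha,\beta$) given by $$[T(u),T(v)]_{T(V)}=T(\{u,v\}),\qquad T(u)\rhd_{T(V)}T(v)=T(u\rhd v),\qquad u,v\in V.$$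
   Context: All vector spaces are over a field $\mathbb{K}$ of characteristic zero. A BiHom-Lie algebra $(A,[\cdot,\cdot],\alpha,\beta)$ is a vector space $A$ with a bilinear bracket and linear maps $\alpha,\beta:A\to A$ such that for all $x,y,z$: $\alpha\beta=\beta\alpha$; $\alpha([x,y])=[\alpha(x),\alpha(y)]$, $\beta([x,y])=[\beta(x),\beta(y)]$; $[\beta(x),\alpha(y)]=-[\beta(y),\alpha(x)]$; and $[\beta^2(x),[\beta(y),\alpha(z)]]+[\beta^2(y),[\beta(z),\alpha(x)]]+[\beta^2(z),[\beta(x),\alpha(y)]]=0$. It is regular if $\alpha,\beta$ are bijective. A morphism of BiHom-Lie algebras is a linear map preserving brackets and commuting with the structure maps. A BiHom-Lie subalgebra is a subspace closed under the bracket and stable under the structure maps. A representation $(V,\rho,\phi,\psi)$ of $(A,[\cdot,\cdot],\alpha,\beta)$ is a vector space $V$ with commuting linear maps $\phi,\psi:V\to V$ and a linear map $\rho:A\to gl(V)$ with $\rho(\alpha(x))\phi=\phi\rho(x)$, $\rho(\beta(x))\psi=\psi\rho(x)$, $\rho([\beta(x),y])\psi=\rho(\alpha\beta(x))\rho(y)-\rho(\beta(y))\rho(\alpha(x))$ for all $x,y\in A$. An $A$-module $\mathbb{K}$-algebra $(V,[\cdot,\cdot]_V,\rho,\phi,\psi)$ consists of a BiHom-Lie algebra $(V,[\cdot,\cdot]_V,\phi,\psi)$ and a linear map $\rho:A\to gl(V)$ such that $(V,\rho,\phi,\psi)$ is a representation of $A$ and $\rho(\alpha\beta(x))[u,v]_V=[\rho(\beta(x))u,\psi(v)]_V+[\psi(u),\rho(\alpha(x))v]_V$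 for all $x\in A$, $u,v\in V$. It is regular if $\phi,\psi$ are bijective. An $\mathcal{O}$-operator of weight $\lambda$ associated to $(V,[\cdot,\cdot]_V,\rho,\phi,\psi)$ (with $A$ and $V$ regular) is a linear map $T:V\to A$ with $T\phi=\alpha T$, $T\psi=\beta T$ and $[T(u),T(v)]=T\big(\rho(T(u))v-\rho(T(\phi^{-1}\psi(v)))\phi\psi^{-1}(u)+\lambda[u,v]_V\big)$ for all $u,v\in V$. A BiHom-post-Lie algebra $(A,[\cdot,\cdot],\rhd,\alpha,\beta)$ is a BiHom-Lie algebra $(A,[\cdot,\cdot],\alpha,\beta)$ with a bilinear product $\rhd$ such that for all $x,y,z$: $\alpha(x\rhd y)=\alpha(x)\rhd\alpha(y)$, $\beta(x\rhd y)=\beta(x)\rhd\beta(y)$; $\alpha\beta(x)\rhd[y,z]=[\beta(x)\rhd y,\beta(z)]+[\beta(y),\alpha(x)\rhd z]$; $[\beta(x),\alpha(y)]\rhd\beta(z)=as_{\alpha,\beta}(\beta(x),\alpha(y),z)-as_{\alpha,\beta}(\beta(y),\alpha(x),z)$, where $as_{\alpha,\beta}(x,y,z)=\alpha(x)\rhd(y\rhd z)-(x\rhd y)\rhd\beta(z)$. When $\alpha,\beta$ are bijective, its sub-adjacent (associated) BiHom-Lie algebra is $A$ with the bracket $x\rhd y-\alpha^{-1}\beta(y)\rhd\alpha\beta^{-1}(x)+[x,y]$ and the same $\alpha,\beta$.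
   Formalization: The induced structure on T(V) is claimed only if T(v)=0 implies T({u,v})=0 for all u,v in V; without this necessary condition the formulas need not be well defined (e.g. [x,y]=y, ρ=ad, λ=1, identity structure maps, T(x)=0, T(y)=-y). *)

theory Defs
  imports Complex_Main
begin

(* Algebraic structures live on a subspace of an ambient vector space (with scalar multiplication
   given by the locale vector_space), so that the image of an O-operator, with the restricted
   structure maps, is itself an instance. Values of operations outside the carrier do not matter. *)

definition linear_on ::
  "('k \<Rightarrow> 'a \<Rightarrow> 'a) \<Rightarrow> ('k \<Rightarrow> 'b \<Rightarrow> 'b) \<Rightarrow> 'a::ab_group_add set \<Rightarrow> 'b::ab_group_add set
    \<Rightarrow> ('a \<Rightarrow> 'b) \<Rightarrow> bool" where
  "linear_on s1 s2 S R f \<longleftrightarrow>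
     (\<forall>x\<in>S. f x \<in> R) \<and>
     (\<forall>x\<in>S. \<forall>y\<in>S. f (x + y) = f x + f y) \<and>
     (\<forall>c. \<forall>x\<in>S. f (s1 c x) = s2 c (f x))"

definition bilinear_on ::
  "('k \<Rightarrow> 'a \<Rightarrow> 'a) \<Rightarrow> ('k \<Rightarrow> 'b \<Rightarrow> 'b) \<Rightarrow> ('k \<Rightarrow> 'c \<Rightarrow> 'c) \<Rightarrow>
    'a::ab_group_add set \<Rightarrow> 'b::ab_group_add set \<Rightarrow> 'c::ab_group_add set
    \<Rightarrow> ('a \<Rightarrow> 'b \<Rightarrow> 'c) \<Rightarrow> bool" where
  "bilinear_on s1 s2 s3 S R Q b \<longleftrightarrow>
     (\<forall>x\<in>S. linear_on s2 s3 R Q (b x)) \<and>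
     (\<forall>y\<in>R. linear_on s1 s3 S Q (\<lambda>x. b x y))"

locale bihom_lie_algebra = vector_space scale
  for scale :: "'k::field_char_0 \<Rightarrow> 'a::ab_group_add \<Rightarrow> 'a" +
  fixes L :: "'a set" and br :: "'a \<Rightarrow> 'a \<Rightarrow> 'a" and \<alpha> \<beta> :: "'a \<Rightarrow> 'a"
  assumes carrier_subspace: "subspace L"
    and bracket_bilinear: "bilinear_on scale scale scale L L L br"
    and alpha_linear: "linear_on scale scale L L \<alpha>"
    and beta_linear: "linear_on scale scale L L \<beta>"
    and alpha_beta_commute: "x \<in> L \<Longrightarrow> \<alpha> (\<beta> x) = \<beta> (\<alpha> x)"
    and alpha_bracket: "x \<in> L \<Longrightarrow> y \<in> L \<Longrightarrow> \<alpha> (br x y) = br (\<alpha> x) (\<alpha> y)"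
    and beta_bracket: "x \<in> L \<Longrightarrow> y \<in> L \<Longrightarrow> \<beta> (br x y) = br (\<beta> x) (\<beta> y)"
    and skew_symmetry: "x \<in> L \<Longrightarrow> y \<in> L \<Longrightarrow> br (\<beta> x) (\<alpha> y) = - br (\<beta> y) (\<alpha> x)"
    and jacobi: "x \<in> L \<Longrightarrow> y \<in> L \<Longrightarrow> z \<in> L \<Longrightarrow>
      br (\<beta> (\<beta> x)) (br (\<beta> y) (\<alpha> z)) + br (\<beta> (\<beta> y)) (br (\<beta> z) (\<alpha> x))
        + br (\<beta> (\<beta> z)) (br (\<beta> x) (\<alpha> y)) = 0"

locale regular_bihom_lie_algebra = bihom_lie_algebra +
  assumes alpha_bij: "bij_betw \<alpha> L L"
    and beta_bij: "bij_betw \<beta> L L"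

definition bihom_lie_morphism ::
  "('k::field_char_0 \<Rightarrow> 'a::ab_group_add \<Rightarrow> 'a) \<Rightarrow> 'a set \<Rightarrow> ('a \<Rightarrow> 'a \<Rightarrow> 'a) \<Rightarrow> ('a \<Rightarrow> 'a) \<Rightarrow> ('a \<Rightarrow> 'a) \<Rightarrow>
   ('k \<Rightarrow> 'b::ab_group_add \<Rightarrow> 'b) \<Rightarrow> 'b set \<Rightarrow> ('b \<Rightarrow> 'b \<Rightarrow> 'b) \<Rightarrow> ('b \<Rightarrow> 'b) \<Rightarrow> ('b \<Rightarrow> 'b) \<Rightarrow>
   ('a \<Rightarrow> 'b) \<Rightarrow> bool" where
  "bihom_lie_morphism s1 L1 br1 \<alpha>1 \<beta>1 s2 L2 br2 \<alpha>2 \<beta>2 f \<longleftrightarrow>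
     bihom_lie_algebra s1 L1 br1 \<alpha>1 \<beta>1 \<and> bihom_lie_algebra s2 L2 br2 \<alpha>2 \<beta>2 \<and>
     linear_on s1 s2 L1 L2 f \<and>
     (\<forall>x\<in>L1. \<forall>y\<in>L1. f (br1 x y) = br2 (f x) (f y)) \<and>
     (\<forall>x\<in>L1. f (\<alpha>1 x) = \<alpha>2 (f x)) \<and>
     (\<forall>x\<in>L1. f (\<beta>1 x) = \<beta>2 (f x))"

definition bihom_lie_subalgebra ::
  "('k::field_char_0 \<Rightarrow> 'a::ab_group_add \<Rightarrow> 'a) \<Rightarrow> 'a set \<Rightarrow> ('a \<Rightarrow> 'a \<Rightarrow> 'a) \<Rightarrow> ('a \<Rightarrow> 'a) \<Rightarrow> ('a \<Rightarrow> 'a) \<Rightarrow>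
   'a set \<Rightarrow> bool" where
  "bihom_lie_subalgebra scale L br \<alpha> \<beta> S \<longleftrightarrow>
     bihom_lie_algebra scale L br \<alpha> \<beta> \<and> S \<subseteq> L \<and> module.subspace scale S \<and>
     (\<forall>x\<in>S. \<forall>y\<in>S. br x y \<in> S) \<and> \<alpha> ` S \<subseteq> S \<and> \<beta> ` S \<subseteq> S"

locale bihom_lie_representation =
  A: bihom_lie_algebra sA A br \<alpha> \<beta> + V: vector_space sV
  for sA :: "'k::field_char_0 \<Rightarrow> 'a::ab_group_add \<Rightarrow> 'a"
    and A :: "'a set" and br :: "'a \<Rightarrow> 'a \<Rightarrow> 'a" and \<alpha> \<beta> :: "'a \<Rightarrow> 'a"
    and sV :: "'k \<Rightarrow> 'v::ab_group_add \<Rightarrow> 'v" +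
  fixes V :: "'v set" and \<rho> :: "'a \<Rightarrow> 'v \<Rightarrow> 'v" and \<phi> \<psi> :: "'v \<Rightarrow> 'v"
  assumes rep_subspace: "V.subspace V"
    and phi_linear: "linear_on sV sV V V \<phi>"
    and psi_linear: "linear_on sV sV V V \<psi>"
    and phi_psi_commute: "v \<in> V \<Longrightarrow> \<phi> (\<psi> v) = \<psi> (\<phi> v)"
    (* a linear map from A to gl(V), uncurried *)
    and rho_linear: "bilinear_on sA sV sV A V V \<rho>"
    and rho_alpha: "x \<in> A \<Longrightarrow> v \<in> V \<Longrightarrow> \<rho> (\<alpha> x) (\<phi> v) = \<phi> (\<rho> x v)"
    and rho_beta: "x \<in> A \<Longrightarrow> v \<in> V \<Longrightarrow> \<rho> (\<beta> x) (\<psi> v) = \<psi> (\<rho> x v)"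
    and rho_bracket: "x \<in> A \<Longrightarrow> y \<in> A \<Longrightarrow> v \<in> V \<Longrightarrow>
      \<rho> (br (\<beta> x) y) (\<psi> v) = \<rho> (\<alpha> (\<beta> x)) (\<rho> y v) - \<rho> (\<beta> y) (\<rho> (\<alpha> x) v)"

locale bihom_module_algebra =
  bihom_lie_representation sA A br \<alpha> \<beta> sV V \<rho> \<phi> \<psi> + VL: bihom_lie_algebra sV V brV \<phi> \<psi>
  for sA :: "'k::field_char_0 \<Rightarrow> 'a::ab_group_add \<Rightarrow> 'a"
    and A :: "'a set" and br :: "'a \<Rightarrow> 'a \<Rightarrow> 'a" and \<alpha> \<beta> :: "'a \<Rightarrow> 'a"
    and sV :: "'k \<Rightarrow> 'v::ab_group_add \<Rightarrow> 'v"
    and V :: "'v set" and brV :: "'v \<Rightarrow> 'v \<Rightarrow> 'v"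
    and \<rho> :: "'a \<Rightarrow> 'v \<Rightarrow> 'v" and \<phi> \<psi> :: "'v \<Rightarrow> 'v" +
  assumes rho_derivation: "x \<in> A \<Longrightarrow> u \<in> V \<Longrightarrow> v \<in> V \<Longrightarrow>
    \<rho> (\<alpha> (\<beta> x)) (brV u v) = brV (\<rho> (\<beta> x) u) (\<psi> v) + brV (\<psi> u) (\<rho> (\<alpha> x) v)"

locale regular_bihom_module_algebra = bihom_module_algebra +
  assumes phi_bij: "bij_betw \<phi> V V"
    and psi_bij: "bij_betw \<psi> V V"

locale o_operator =
  regular_bihom_lie_algebra sA A br \<alpha> \<beta> +
  regular_bihom_module_algebra sA A br \<alpha> \<beta> sV V brV \<rho> \<phi> \<psi>
  for sA :: "'k::field_char_0 \<Rightarrow> 'a::ab_group_add \<Rightarrow> 'a"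
    and A :: "'a set" and br :: "'a \<Rightarrow> 'a \<Rightarrow> 'a" and \<alpha> \<beta> :: "'a \<Rightarrow> 'a"
    and sV :: "'k \<Rightarrow> 'v::ab_group_add \<Rightarrow> 'v"
    and V :: "'v set" and brV :: "'v \<Rightarrow> 'v \<Rightarrow> 'v"
    and \<rho> :: "'a \<Rightarrow> 'v \<Rightarrow> 'v" and \<phi> \<psi> :: "'v \<Rightarrow> 'v" +
  fixes wt :: 'k and T :: "'v \<Rightarrow> 'a"
  assumes T_linear: "linear_on sV sA V A T"
    and T_phi: "u \<in> V \<Longrightarrow> T (\<phi> u) = \<alpha> (T u)"
    and T_psi: "u \<in> V \<Longrightarrow> T (\<psi> u) = \<beta> (T u)"
    and T_bracket: "u \<in> V \<Longrightarrow> v \<in> V \<Longrightarrow>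
      br (T u) (T v) =
        T (\<rho> (T u) v - \<rho> (T (inv_into V \<phi> (\<psi> v))) (\<phi> (inv_into V \<psi> u)) + sV wt (brV u v))"

definition bihom_associator ::
  "('a::ab_group_add \<Rightarrow> 'a \<Rightarrow> 'a) \<Rightarrow> ('a \<Rightarrow> 'a) \<Rightarrow> ('a \<Rightarrow> 'a) \<Rightarrow> 'a \<Rightarrow> 'a \<Rightarrow> 'a \<Rightarrow> 'a" where
  "bihom_associator rhd \<alpha> \<beta> x y z = rhd (\<alpha> x) (rhd y z) - rhd (rhd x y) (\<beta> z)"

locale bihom_post_lie_algebra =
  bihom_lie_algebra scale L br \<alpha> \<beta>
  for scale :: "'k::field_char_0 \<Rightarrow> 'a::ab_group_add \<Rightarrow> 'a"
    and L :: "'a set" and br rhd :: "'a \<Rightarrow> 'a \<Rightarrow> 'a" and \<alpha> \<beta> :: "'a \<Rightarrow> 'a" +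
  assumes rhd_bilinear: "bilinear_on scale scale scale L L L rhd"
    and alpha_rhd: "x \<in> L \<Longrightarrow> y \<in> L \<Longrightarrow> \<alpha> (rhd x y) = rhd (\<alpha> x) (\<alpha> y)"
    and beta_rhd: "x \<in> L \<Longrightarrow> y \<in> L \<Longrightarrow> \<beta> (rhd x y) = rhd (\<beta> x) (\<beta> y)"
    and rhd_derivation: "x \<in> L \<Longrightarrow> y \<in> L \<Longrightarrow> z \<in> L \<Longrightarrow>
      rhd (\<alpha> (\<beta> x)) (br y z) = br (rhd (\<beta> x) y) (\<beta> z) + br (\<beta> y) (rhd (\<alpha> x) z)"
    and bracket_rhd: "x \<in> L \<Longrightarrow> y \<in> L \<Longrightarrow> z \<in> L \<Longrightarrow>
      rhd (br (\<beta> x) (\<alpha> y)) (\<beta> z) =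
        bihom_associator rhd \<alpha> \<beta> (\<beta> x) (\<alpha> y) z - bihom_associator rhd \<alpha> \<beta> (\<beta> y) (\<alpha> x) z"

(* Meaningful when \<alpha> and \<beta> are bijective on L. *)
definition subadjacent_bracket ::
  "'a::ab_group_add set \<Rightarrow> ('a \<Rightarrow> 'a \<Rightarrow> 'a) \<Rightarrow> ('a \<Rightarrow> 'a \<Rightarrow> 'a) \<Rightarrow> ('a \<Rightarrow> 'a) \<Rightarrow> ('a \<Rightarrow> 'a) \<Rightarrow> 'a \<Rightarrow> 'a \<Rightarrow> 'a" where
  "subadjacent_bracket L br rhd \<alpha> \<beta> x y =
     rhd x y - rhd (inv_into L \<alpha> (\<beta> y)) (\<alpha> (inv_into L \<beta> x)) + br x y"

end

theory Submission
  imports Defs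
begin

text \<open>
  The only place where inverses of the structure maps occur is the second term of the sub-adjacent
  bracket and of the identity defining an O-operator. Both are meant to be evaluated at a pair
  \<open>(\<beta> x, \<alpha> y)\<close>, respectively \<open>(\<psi> u, \<phi> v)\<close>: there the inverses cancel and the bracket becomes
  \<open>\<beta> x \<rhd> \<alpha> y - \<beta> y \<rhd> \<alpha> x + [\<beta> x, \<alpha> y]\<close>. Since the structure maps are bijective, every pair has this
  form, and the whole proof is carried out in these coordinates.

  In these coordinates the defining identity of \<open>T\<close> expresses \<open>T (\<lambda>[\<psi> u, \<phi> v])\<close> as
  \<open>[T (\<psi> u), T (\<phi> v)]\<close> corrected by \<open>T (\<psi> u \<rhd> \<phi> v)\<close> and \<open>T (\<psi> v \<rhd> \<phi> u)\<close> (lemma \<open>T_bracket_psi_phi\<close>).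
  Letting \<open>\<rho>\<close> act, the bracket turns into a commutator of actions, and the two corrections are
  the missing halves of the two associators. This is the one axiom of a BiHom-post-Lie algebra with
  content; the other ones are the axioms of a module algebra at \<open>T u\<close>, rescaled by the weight.

  The sub-adjacent bracket of any BiHom-post-Lie algebra with bijective structure maps satisfies the
  Jacobi identity (\<open>subadjacent_bihom_lie_algebra\<close>), and for the induced algebra the
  defining identity of \<open>T\<close> says literally that \<open>T\<close> maps the sub-adjacent bracket to the bracket
  of \<open>A\<close>. In particular \<open>T ` V\<close> is a subalgebra.

  A product descends to \<open>T ` V\<close> exactly when the kernel of \<open>T\<close> is a two-sided ideal for it. For the
  curly bracket the ideal property in one argument is assumed, and skew-symmetry yields the other one. For \<open>\<rhd>\<close>,
  the left factor enters only through \<open>T u\<close>; if \<open>T v = 0\<close>, then in the defining identity for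
  \<open>[T u, T v]\<close> every term except \<open>T (u \<rhd> v)\<close> vanishes. Once the products are well defined, all
  axioms pass from \<open>V\<close> to its image (\<open>bihom_post_lie_algebra_image\<close>).
\<close>

section \<open>Linear maps on subspaces\<close>

lemma linear_onD:
  assumes "linear_on s1 s2 S R f"
  shows "x \<in> S \<Longrightarrow> f x \<in> R"
    and "x \<in> S \<Longrightarrow> y \<in> S \<Longrightarrow> f (x + y) = f x + f y"
    and "x \<in> S \<Longrightarrow> f (s1 c x) = s2 c (f x)"
  using assms by (auto simp: linear_on_def)

lemma bilinear_onD:
  assumes "bilinear_on s1 s2 s3 S R Q b"
  shows "x \<in> S \<Longrightarrow> linear_on s2 s3 R Q (b x)"
    and "y \<in> R \<Longrightarrow> linear_on s1 s3 S Q (\<lambda>x. b x y)"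
  using assms by (auto simp: bilinear_on_def)

lemma (in vector_space) linear_on_group_hom:
  assumes "subspace S" and f: "linear_on scale s2 S R f"
  shows "f 0 = 0"
    and "x \<in> S \<Longrightarrow> f (- x) = - f x"
    and "x \<in> S \<Longrightarrow> y \<in> S \<Longrightarrow> f (x - y) = f x - f y"
proof -
  have add: "\<And>x y. x \<in> S \<Longrightarrow> y \<in> S \<Longrightarrow> f (x + y) = f x + f y"
    using f by (rule linear_onD)
  have "0 \<in> S" by (rule subspace_0[OF assms(1)])
  from add[OF this this] show zero: "f 0 = 0" by simp
  show neg: "f (- x) = - f x" if "x \<in> S" for x
    using add[OF that subspace_neg[OF assms(1) that]] zero by (simp add: eq_neg_iff_add_eq_0 add.commute)
  show "f (x - y) = f x - f y" if "x \<in> S" "y \<in> S"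
    using add[OF that(1) subspace_neg[OF assms(1) that(2)]] neg[OF that(2)] by simp
qed

lemma (in vector_space) subspace_linear_on_image:
  assumes "subspace S" "vector_space s2" and f: "linear_on scale s2 S R f"
  shows "module.subspace s2 (f ` S)"
proof -
  interpret W: vector_space s2 by fact
  show ?thesis
    unfolding W.subspace_def
  proof (intro conjI ballI allI)
    show "0 \<in> f ` S"
      using linear_on_group_hom(1)[OF assms(1) f] subspace_0[OF assms(1)] by (metis imageI)
    fix x y c assume "x \<in> f ` S"
    then obtain a where a: "a \<in> S" "x = f a" by blast
    show "s2 c x \<in> f ` S"
      using a linear_onD(3)[OF f a(1)] subspace_scale[OF assms(1) a(1)] by (metis imageI)
    assume "y \<in> f ` S"
    then obtain b where b: "b \<in> S" "y = f b" by blast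
    show "x + y \<in> f ` S"
      using a b linear_onD(2)[OF f a(1) b(1)] subspace_add[OF assms(1) a(1) b(1)] by (metis imageI)
  qed
qed

text \<open>Linearity may be tested after composition with a linear surjection. This gives linearity on
  images, and also linearity in arguments that are preprocessed by inverses of linear maps.\<close>

lemma (in vector_space) linear_on_factor:
  assumes "subspace S" and f: "linear_on scale s2 S R f" and surj: "f ` S = R"
    and gf: "linear_on scale s3 S Q (\<lambda>a. g (f a))"
  shows "linear_on s2 s3 R Q g"
  unfolding linear_on_def
proof (intro conjI ballI allI)
  fix x y c assume "x \<in> R"
  then obtain a where a: "a \<in> S" "x = f a" using surj by blast
  show "g x \<in> Q" using linear_onD(1)[OF gf a(1)] a by simp
  show "g (s2 c x) = s3 c (g x)"
    using linear_onD(3)[OF gf a(1)] linear_onD(3)[OF f a(1)] a by simp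
  assume "y \<in> R"
  then obtain b where b: "b \<in> S" "y = f b" using surj by blast
  show "g (x + y) = g x + g y"
    using linear_onD(2)[OF gf a(1) b(1)] linear_onD(2)[OF f a(1) b(1)] a b by simp
qed

lemma (in vector_space) bilinear_on_factor:
  assumes "subspace S" and f: "linear_on scale s2 S R f" "f ` S = R"
    and g: "linear_on scale s2 S R g" "g ` S = R"
    and B: "bilinear_on scale scale s3 S S Q (\<lambda>a b. B (f a) (g b))"
  shows "bilinear_on s2 s2 s3 R R Q B"
  unfolding bilinear_on_def
proof (intro conjI ballI)
  fix x assume "x \<in> R"
  then obtain a where a: "a \<in> S" "x = f a" using f by blast
  show "linear_on s2 s3 R Q (B x)"
    using linear_on_factor[OF assms(1) g] bilinear_onD(1)[OF B a(1)] a by simp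
next
  fix y assume "y \<in> R"
  then obtain b where b: "b \<in> S" "y = g b" using g by blast
  show "linear_on s2 s3 R Q (\<lambda>x. B x y)"
    using linear_on_factor[OF assms(1) f, where g = "\<lambda>x. B x y"] bilinear_onD(2)[OF B b(1)] b
    by simp
qed

text \<open>The product carried over to an image is computed on arbitrarily chosen preimages. Replacing one
  argument by another with the same image changes it by an element of the kernel, so
  independence of the choice is precisely the ideal property of the kernel.\<close>

lemma (in vector_space) bilinear_on_descends:
  assumes S: "subspace S" and f: "linear_on scale s2 S R f"
    and B: "bilinear_on scale scale scale S S S B"
    and left: "\<And>x y. x \<in> S \<Longrightarrow> y \<in> S \<Longrightarrow> f x = 0 \<Longrightarrow> f (B x y) = 0"
    and right: "\<And>x y. x \<in> S \<Longrightarrow> y \<in> S \<Longrightarrow> f y = 0 \<Longrightarrow> f (B x y) = 0"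
    and xy: "x \<in> S" "y \<in> S"
  shows "f (B (inv_into S f (f x)) (inv_into S f (f y))) = f (B x y)"
proof -
  let ?x = "inv_into S f (f x)" and ?y = "inv_into S f (f y)"
  have x: "?x \<in> S" "f ?x = f x" and y: "?y \<in> S" "f ?y = f y"
    using xy by (auto simp: inv_into_into f_inv_into_f)
  note hom = linear_on_group_hom(3)[OF S f]
  have cl: "\<And>a b. a \<in> S \<Longrightarrow> b \<in> S \<Longrightarrow> B a b \<in> S"
    using linear_onD(1)[OF bilinear_onD(1)[OF B]] .
  have "f (B (?x - x) ?y) = 0"
    using left[of "?x - x" ?y] x y xy hom[of ?x x] by (simp add: subspace_diff[OF S])
  moreover have "f (B x (?y - y)) = 0"
    using right[of x "?y - y"] x y xy hom[of ?y y] by (simp add: subspace_diff[OF S])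
  ultimately show ?thesis
    using x y xy cl hom linear_on_group_hom(3)[OF S bilinear_onD(1)[OF B]]
      linear_on_group_hom(3)[OF S bilinear_onD(2)[OF B]] by simp
qed

lemma bij_betw_ex_preimage: "bij_betw f S R \<Longrightarrow> y \<in> R \<Longrightarrow> \<exists>x\<in>S. y = f x"
  by (auto simp: bij_betw_def)

context bihom_lie_algebra
begin

lemmas carrier_closed =
  subspace_add[OF carrier_subspace] subspace_diff[OF carrier_subspace]
  subspace_neg[OF carrier_subspace] subspace_scale[OF carrier_subspace]
  linear_onD(1)[OF alpha_linear] linear_onD(1)[OF beta_linear]
  linear_onD(1)[OF bilinear_onD(1)[OF bracket_bilinear]]

lemmas map_linear =
  linear_onD(2,3)[OF alpha_linear] linear_onD(2,3)[OF beta_linear]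
  linear_on_group_hom(3)[OF carrier_subspace alpha_linear]
  linear_on_group_hom(3)[OF carrier_subspace beta_linear]

lemmas bracket_linear =
  linear_onD(2,3)[OF bilinear_onD(1)[OF bracket_bilinear]]
  linear_onD(2,3)[OF bilinear_onD(2)[OF bracket_bilinear]]
  linear_on_group_hom(3)[OF carrier_subspace bilinear_onD(1)[OF bracket_bilinear]]
  linear_on_group_hom(3)[OF carrier_subspace bilinear_onD(2)[OF bracket_bilinear]]

end

section \<open>The sub-adjacent BiHom-Lie algebra\<close>

context bihom_post_lie_algebra
begin

lemmas rhd_closed = linear_onD(1)[OF bilinear_onD(1)[OF rhd_bilinear]]

lemmas rhd_linear =
  linear_onD(2,3)[OF bilinear_onD(1)[OF rhd_bilinear]]
  linear_onD(2,3)[OF bilinear_onD(2)[OF rhd_bilinear]]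
  linear_on_group_hom(3)[OF carrier_subspace bilinear_onD(1)[OF rhd_bilinear]]
  linear_on_group_hom(3)[OF carrier_subspace bilinear_onD(2)[OF rhd_bilinear]]

text \<open>The inverses in the definition of the sub-adjacent bracket cancel on arguments of this form;
  by bijectivity no generality is lost.\<close>

lemma subadjacent_bracket_beta_alpha:
  assumes "bij_betw \<alpha> L L" "bij_betw \<beta> L L" "x \<in> L" "y \<in> L"
  shows "subadjacent_bracket L br rhd \<alpha> \<beta> (\<beta> x) (\<alpha> y) =
    rhd (\<beta> x) (\<alpha> y) - rhd (\<beta> y) (\<alpha> x) + br (\<beta> x) (\<alpha> y)"
  using assms
  by (simp add: subadjacent_bracket_def alpha_beta_commute[symmetric] carrier_closed
      bij_betw_inv_into_left)

text \<open>For the Jacobi identity each argument is written as \<open>\<alpha> a\<close>, so that the inner bracket is in the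
  image of \<open>\<alpha>\<close> and the outer one can be expanded as well. The expansion has three kinds of terms:
  iterated products \<open>\<rhd>\<close> (left over after the compatibility of the bracket with \<open>\<rhd>\<close> has removed
  those bracketed to the left), brackets containing one product, and iterated brackets. The first
  two kinds cancel in the cyclic sum, and the third vanishes by the Jacobi identity of the
  given bracket.\<close>

lemma subadjacent_bihom_lie_algebra:
  assumes bij: "bij_betw \<alpha> L L" "bij_betw \<beta> L L"
  shows "bihom_lie_algebra scale L (subadjacent_bracket L br rhd \<alpha> \<beta>) \<alpha> \<beta>"
proof -
  let ?S = "subadjacent_bracket L br rhd \<alpha> \<beta>"
  note S = subadjacent_bracket_beta_alpha[OF bij]
  note cl = carrier_closed rhd_closed
  have surj: "\<alpha> ` L = L" "\<beta> ` L = L" using bij by (auto simp: bij_betw_def)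
  have bilin: "bilinear_on scale scale scale L L L ?S"
  proof (rule bilinear_on_factor[OF carrier_subspace beta_linear surj(2) alpha_linear surj(1)])
    have "bilinear_on scale scale scale L L L
        (\<lambda>a b. rhd (\<beta> a) (\<alpha> b) - rhd (\<beta> b) (\<alpha> a) + br (\<beta> a) (\<alpha> b))"
      unfolding bilinear_on_def linear_on_def
      by (auto simp: cl map_linear bracket_linear rhd_linear scale_right_diff_distrib
          scale_right_distrib)
    then show "bilinear_on scale scale scale L L L (\<lambda>a b. ?S (\<beta> a) (\<alpha> b))"
      unfolding bilinear_on_def linear_on_def by (simp add: S cl)
  qed
  have alpha_S: "\<alpha> (?S x y) = ?S (\<alpha> x) (\<alpha> y)" and beta_S: "\<beta> (?S x y) = ?S (\<beta> x) (\<beta> y)"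
    if xyL: "x \<in> L" "y \<in> L" for x y
  proof -
    obtain a b where ab: "a \<in> L" "b \<in> L" and xy: "x = \<beta> a" "y = \<alpha> b"
      using bij_betw_ex_preimage[OF bij(2) xyL(1)] bij_betw_ex_preimage[OF bij(1) xyL(2)] by metis
    show "\<alpha> (?S x y) = ?S (\<alpha> x) (\<alpha> y)"
      using ab S[of "\<alpha> a" "\<alpha> b"]
      by (simp add: xy S cl map_linear alpha_rhd alpha_bracket alpha_beta_commute)
    show "\<beta> (?S x y) = ?S (\<beta> x) (\<beta> y)"
      using ab S[of "\<beta> a" "\<beta> b"]
      by (simp add: xy S cl map_linear beta_rhd beta_bracket alpha_beta_commute)
  qed
  have skew: "?S (\<beta> x) (\<alpha> y) = - ?S (\<beta> y) (\<alpha> x)" if "x \<in> L" "y \<in> L" for x y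
    using that skew_symmetry[OF that] by (simp add: S)
  have jac: "?S (\<beta> (\<beta> x)) (?S (\<beta> y) (\<alpha> z)) + ?S (\<beta> (\<beta> y)) (?S (\<beta> z) (\<alpha> x))
        + ?S (\<beta> (\<beta> z)) (?S (\<beta> x) (\<alpha> y)) = 0"
    if xyz: "x \<in> L" "y \<in> L" "z \<in> L" for x y z
  proof -
    define D where "D x y z =
      rhd (\<beta> (\<beta> (\<alpha> x))) (rhd (\<beta> (\<alpha> y)) (\<alpha> (\<alpha> z)))" for x y z
    define E where "E x y z =
      br (\<beta> (\<beta> (\<alpha> x))) (rhd (\<beta> (\<alpha> y)) (\<alpha> (\<alpha> z)))" for x y z
    define F where "F x y z =
      br (\<beta> (\<beta> (\<alpha> x))) (br (\<beta> (\<alpha> y)) (\<alpha> (\<alpha> z)))" for x y z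
    \<comment> \<open>Every term is brought to one of these three shapes, in which \<open>\<beta>\<^sup>2\<alpha>\<close>, \<open>\<beta>\<alpha>\<close> and \<open>\<alpha>\<^sup>2\<close> act on
      the first, second and third argument; the cyclic sum is then a matter of
      permuting arguments.\<close>
    have expand: "?S (\<beta> (\<beta> (\<alpha> a))) (?S (\<beta> (\<alpha> b)) (\<alpha> (\<alpha> c))) =
      D a b c - D a c b - D b c a + D c b a
      + (E b a c - E c a b) + (E a b c - E a c b) + F a b c"
      if abc: "a \<in> L" "b \<in> L" "c \<in> L" for a b c
    proof -
      let ?w = "rhd (\<beta> b) (\<alpha> c) - rhd (\<beta> c) (\<alpha> b) + br (\<beta> b) (\<alpha> c)"
      have w: "?w \<in> L" using abc by (simp add: cl)
      have "?S (\<beta> (\<alpha> b)) (\<alpha> (\<alpha> c)) = \<alpha> ?w"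
        using abc by (simp add: S cl alpha_S map_linear alpha_rhd alpha_bracket alpha_beta_commute)
      then have 1: "?S (\<beta> (\<beta> (\<alpha> a))) (?S (\<beta> (\<alpha> b)) (\<alpha> (\<alpha> c))) =
          rhd (\<beta> (\<beta> (\<alpha> a))) (\<alpha> ?w) - rhd (\<beta> ?w) (\<alpha> (\<beta> (\<alpha> a)))
          + br (\<beta> (\<beta> (\<alpha> a))) (\<alpha> ?w)"
        using S[of "\<beta> (\<alpha> a)" ?w] abc w by (simp add: cl)
      have 2: "\<alpha> ?w = rhd (\<beta> (\<alpha> b)) (\<alpha> (\<alpha> c)) - rhd (\<beta> (\<alpha> c)) (\<alpha> (\<alpha> b))
          + br (\<beta> (\<alpha> b)) (\<alpha> (\<alpha> c))"
        using abc by (simp add: cl map_linear alpha_rhd alpha_bracket alpha_beta_commute)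
      have 3: "\<beta> ?w = rhd (\<beta> (\<beta> b)) (\<beta> (\<alpha> c)) - rhd (\<beta> (\<beta> c)) (\<beta> (\<alpha> b))
          + br (\<beta> (\<beta> b)) (\<beta> (\<alpha> c))"
        using abc by (simp add: cl map_linear beta_rhd beta_bracket)
      \<comment> \<open>The products bracketed to the left here cancel those that come from \<open>rhd (\<beta> ?w)\<close>.\<close>
      have 4: "rhd (br (\<beta> (\<beta> b)) (\<beta> (\<alpha> c))) (\<beta> (\<alpha> (\<alpha> a))) =
        D b c a - rhd (rhd (\<beta> (\<beta> b)) (\<beta> (\<alpha> c))) (\<beta> (\<alpha> (\<alpha> a)))
        - (D c b a - rhd (rhd (\<beta> (\<beta> c)) (\<beta> (\<alpha> b))) (\<beta> (\<alpha> (\<alpha> a))))"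
        using bracket_rhd[of "\<beta> b" "\<beta> c" "\<alpha> (\<alpha> a)"] abc
        by (simp add: cl alpha_beta_commute bihom_associator_def D_def)
      have 5: "rhd (\<beta> (\<beta> (\<alpha> a))) (br (\<beta> (\<alpha> b)) (\<alpha> (\<alpha> c))) = E b a c - E c a b"
      proof -
        \<comment> \<open>Skew-symmetry brings the product to the second argument, as in the shape \<open>E\<close>.\<close>
        have "br (rhd (\<beta> (\<beta> a)) (\<beta> (\<alpha> b))) (\<beta> (\<alpha> (\<alpha> c))) = - E c a b"
          using skew_symmetry[of "rhd (\<beta> a) (\<alpha> b)" "\<beta> (\<alpha> c)"] abc
          by (simp add: cl beta_rhd alpha_rhd alpha_beta_commute E_def)
        then show ?thesis
          using rhd_derivation[of "\<beta> a" "\<beta> (\<alpha> b)" "\<alpha> (\<alpha> c)"] abc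
          by (simp add: cl alpha_beta_commute E_def)
      qed
      show ?thesis
        unfolding 1 2 3 using abc 4 5
        by (simp add: cl rhd_linear bracket_linear alpha_beta_commute D_def E_def F_def)
    qed
    obtain a b c where abc: "a \<in> L" "b \<in> L" "c \<in> L" "x = \<alpha> a" "y = \<alpha> b" "z = \<alpha> c"
      using bij_betw_ex_preimage[OF bij(1) xyz(1)] bij_betw_ex_preimage[OF bij(1) xyz(2)] bij_betw_ex_preimage[OF bij(1) xyz(3)]
      by metis
    have "F a b c + F b c a + F c a b = 0"
      using jacobi[of "\<alpha> a" "\<alpha> b" "\<alpha> c"] abc by (simp add: cl F_def)
    then show ?thesis
      unfolding abc(4-6) using abc(1-3) by (simp add: expand algebra_simps)
  qed
  show ?thesis
    by unfold_locales (fact carrier_subspace bilin alpha_linear beta_linear alpha_beta_commute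
        alpha_S beta_S skew jac)+
qed

section \<open>Images of BiHom-post-Lie algebras\<close>

text \<open>All axioms are identities between terms built from the operations, so each of them is the image
  under \<open>f\<close> of the same axiom for preimages.\<close>

lemma bihom_post_lie_algebra_image:
  assumes s2: "vector_space s2" and f: "linear_on scale s2 L R f"
    and f_alpha: "\<And>x. x \<in> L \<Longrightarrow> f (\<alpha> x) = \<alpha>' (f x)"
    and f_beta: "\<And>x. x \<in> L \<Longrightarrow> f (\<beta> x) = \<beta>' (f x)"
    and f_br: "\<And>x y. x \<in> L \<Longrightarrow> y \<in> L \<Longrightarrow> f (br x y) = br' (f x) (f y)"
    and f_rhd: "\<And>x y. x \<in> L \<Longrightarrow> y \<in> L \<Longrightarrow> f (rhd x y) = rhd' (f x) (f y)"
  shows "bihom_post_lie_algebra s2 (f ` L) br' rhd' \<alpha>' \<beta>'"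
proof -
  interpret W: vector_space s2 by fact
  note cl = carrier_closed rhd_closed
  note pull = f_alpha[symmetric] f_beta[symmetric] f_br[symmetric] f_rhd[symmetric]
  note hom = linear_onD(2)[OF f, symmetric] linear_on_group_hom(2,3)[OF carrier_subspace f, symmetric]
  have f': "linear_on scale s2 L (f ` L) f"
    using f by (auto simp: linear_on_def)
  note fact1 = linear_on_factor[OF carrier_subspace f' refl]
  note fact2 = bilinear_on_factor[OF carrier_subspace f' refl f' refl]
  have sub: "W.subspace (f ` L)"
    by (rule subspace_linear_on_image[OF carrier_subspace s2 f])
  show ?thesis
  proof unfold_locales
    show "W.subspace (f ` L)" by (rule sub)
    show "bilinear_on s2 s2 s2 (f ` L) (f ` L) (f ` L) br'"
    proof (rule fact2)
      have "bilinear_on scale scale s2 L L (f ` L) (\<lambda>a b. f (br a b))"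
        by (auto simp: bilinear_on_def linear_on_def cl bracket_linear linear_onD(2,3)[OF f])
      then show "bilinear_on scale scale s2 L L (f ` L) (\<lambda>a b. br' (f a) (f b))"
        by (simp add: bilinear_on_def linear_on_def f_br[symmetric] cl)
    qed
    show "bilinear_on s2 s2 s2 (f ` L) (f ` L) (f ` L) rhd'"
    proof (rule fact2)
      have "bilinear_on scale scale s2 L L (f ` L) (\<lambda>a b. f (rhd a b))"
        by (auto simp: bilinear_on_def linear_on_def cl rhd_linear linear_onD(2,3)[OF f])
      then show "bilinear_on scale scale s2 L L (f ` L) (\<lambda>a b. rhd' (f a) (f b))"
        by (simp add: bilinear_on_def linear_on_def f_rhd[symmetric] cl)
    qed
    show "linear_on s2 s2 (f ` L) (f ` L) \<alpha>'"
    proof (rule fact1)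
      have "linear_on scale s2 L (f ` L) (\<lambda>a. f (\<alpha> a))"
        by (auto simp: linear_on_def cl map_linear linear_onD(2,3)[OF f])
      then show "linear_on scale s2 L (f ` L) (\<lambda>a. \<alpha>' (f a))"
        by (simp add: linear_on_def f_alpha[symmetric] cl)
    qed
    show "linear_on s2 s2 (f ` L) (f ` L) \<beta>'"
    proof (rule fact1)
      have "linear_on scale s2 L (f ` L) (\<lambda>a. f (\<beta> a))"
        by (auto simp: linear_on_def cl map_linear linear_onD(2,3)[OF f])
      then show "linear_on scale s2 L (f ` L) (\<lambda>a. \<beta>' (f a))"
        by (simp add: linear_on_def f_beta[symmetric] cl)
    qed
  next
    fix x assume "x \<in> f ` L"
    then show "\<alpha>' (\<beta>' x) = \<beta>' (\<alpha>' x)" by (auto simp: pull cl alpha_beta_commute)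
  next
    fix x y assume "x \<in> f ` L" "y \<in> f ` L"
    then obtain a b where ab: "a \<in> L" "b \<in> L" "x = f a" "y = f b" by blast
    show "\<alpha>' (br' x y) = br' (\<alpha>' x) (\<alpha>' y)" using ab by (simp add: pull cl alpha_bracket)
    show "\<beta>' (br' x y) = br' (\<beta>' x) (\<beta>' y)" using ab by (simp add: pull cl beta_bracket)
    show "\<alpha>' (rhd' x y) = rhd' (\<alpha>' x) (\<alpha>' y)" using ab by (simp add: pull cl alpha_rhd)
    show "\<beta>' (rhd' x y) = rhd' (\<beta>' x) (\<beta>' y)" using ab by (simp add: pull cl beta_rhd)
    show "br' (\<beta>' x) (\<alpha>' y) = - br' (\<beta>' y) (\<alpha>' x)"
      using ab skew_symmetry[OF ab(1,2)] by (simp add: pull cl hom)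
  next
    fix x y z assume "x \<in> f ` L" "y \<in> f ` L" "z \<in> f ` L"
    then obtain a b c where abc: "a \<in> L" "b \<in> L" "c \<in> L" "x = f a" "y = f b" "z = f c" by blast
    show "br' (\<beta>' (\<beta>' x)) (br' (\<beta>' y) (\<alpha>' z)) + br' (\<beta>' (\<beta>' y)) (br' (\<beta>' z) (\<alpha>' x))
        + br' (\<beta>' (\<beta>' z)) (br' (\<beta>' x) (\<alpha>' y)) = 0"
      using abc jacobi[OF abc(1-3)]
      by (simp add: pull cl hom linear_on_group_hom(1)[OF carrier_subspace f])
    show "rhd' (\<alpha>' (\<beta>' x)) (br' y z) = br' (rhd' (\<beta>' x) y) (\<beta>' z) + br' (\<beta>' y) (rhd' (\<alpha>' x) z)"
      using abc rhd_derivation[OF abc(1-3)] by (simp add: pull cl hom)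
    show "rhd' (br' (\<beta>' x) (\<alpha>' y)) (\<beta>' z) =
        bihom_associator rhd' \<alpha>' \<beta>' (\<beta>' x) (\<alpha>' y) z - bihom_associator rhd' \<alpha>' \<beta>' (\<beta>' y) (\<alpha>' x) z"
      using abc bracket_rhd[OF abc(1-3)] by (simp add: bihom_associator_def pull cl hom)
  qed
qed

end

section \<open>The product induced by an O-operator\<close>

context o_operator
begin

lemmas T_closed = linear_onD(1)[OF T_linear]
lemmas rho_closed = linear_onD(1)[OF bilinear_onD(1)[OF rho_linear]]

lemmas T_hom = linear_onD(2,3)[OF T_linear] V.linear_on_group_hom(3)[OF VL.carrier_subspace T_linear]

lemmas rho_hom =
  linear_onD(2,3)[OF bilinear_onD(1)[OF rho_linear]]
  linear_onD(2,3)[OF bilinear_onD(2)[OF rho_linear]]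
  linear_on_group_hom(3)[OF carrier_subspace bilinear_onD(2)[OF rho_linear]]

text \<open>The identity defining an O-operator, freed of inverses and solved for the weighted bracket.\<close>

lemma T_bracket_psi_phi:
  assumes "u \<in> V" "v \<in> V"
  shows "T (sV wt (brV (\<psi> u) (\<phi> v))) =
    br (\<beta> (T u)) (\<alpha> (T v)) - T (\<rho> (T (\<psi> u)) (\<phi> v)) + T (\<rho> (T (\<psi> v)) (\<phi> u))"
  using assms T_bracket[of "\<psi> u" "\<phi> v"] phi_bij psi_bij
  by (simp add: T_phi T_psi VL.carrier_closed bij_betw_inv_into_left phi_psi_commute[symmetric]
      T_hom rho_closed T_closed carrier_closed)

lemma induced_bihom_post_lie_algebra:
  assumes curly: "\<And>u v. u \<in> V \<Longrightarrow> v \<in> V \<Longrightarrow> curly u v = sV wt (brV u v)"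
    and rhd: "\<And>u v. u \<in> V \<Longrightarrow> v \<in> V \<Longrightarrow> rhd u v = \<rho> (T u) v"
  shows "bihom_post_lie_algebra sV V curly rhd \<phi> \<psi>"
proof unfold_locales
  note cl = VL.carrier_closed T_closed rho_closed carrier_closed
  note sc = V.scale_right_distrib V.scale_right_diff_distrib
  show "bilinear_on sV sV sV V V V curly"
    by (auto simp: bilinear_on_def linear_on_def curly cl VL.bracket_linear sc V.scale_left_commute)
  show "bilinear_on sV sV sV V V V rhd"
    by (auto simp: bilinear_on_def linear_on_def rhd cl rho_hom T_hom)
  fix x y assume xy: "x \<in> V" "y \<in> V"
  show "\<phi> (curly x y) = curly (\<phi> x) (\<phi> y)" "\<psi> (curly x y) = curly (\<psi> x) (\<psi> y)"
    using xy by (simp_all add: curly cl VL.map_linear VL.alpha_bracket VL.beta_bracket)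
  show "curly (\<psi> x) (\<phi> y) = - curly (\<psi> y) (\<phi> x)"
    using xy VL.skew_symmetry[OF xy] by (simp add: curly cl)
  show "\<phi> (rhd x y) = rhd (\<phi> x) (\<phi> y)" "\<psi> (rhd x y) = rhd (\<psi> x) (\<psi> y)"
    using xy by (simp_all add: rhd cl T_phi T_psi rho_alpha rho_beta)
  fix z assume z: "z \<in> V"
  show "curly (\<psi> (\<psi> x)) (curly (\<psi> y) (\<phi> z)) + curly (\<psi> (\<psi> y)) (curly (\<psi> z) (\<phi> x))
        + curly (\<psi> (\<psi> z)) (curly (\<psi> x) (\<phi> y)) = 0"
    using xy z VL.jacobi[OF xy z]
    by (simp add: curly cl VL.bracket_linear sc[symmetric] del: V.scale_scale)
  show "rhd (\<phi> (\<psi> x)) (curly y z) = curly (rhd (\<psi> x) y) (\<psi> z) + curly (\<psi> y) (rhd (\<phi> x) z)"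
    using xy z rho_derivation[of "T x" y z]
    by (simp add: curly rhd cl rho_hom T_phi T_psi sc)
  \<comment> \<open>The commutator of actions supplies the iterated products in the two associators; the two
    correction terms in \<open>T_bracket_psi_phi\<close> supply the products bracketed to the left.\<close>
  have "\<rho> (br (\<beta> (T x)) (\<alpha> (T y))) (\<psi> z) =
      \<rho> (\<alpha> (\<beta> (T x))) (\<rho> (\<alpha> (T y)) z) - \<rho> (\<alpha> (\<beta> (T y))) (\<rho> (\<alpha> (T x)) z)"
    using xy z rho_bracket[of "T x" "\<alpha> (T y)" z] by (simp add: cl alpha_beta_commute)
  then show "rhd (curly (\<psi> x) (\<phi> y)) (\<psi> z) =
      bihom_associator rhd \<phi> \<psi> (\<psi> x) (\<phi> y) z - bihom_associator rhd \<phi> \<psi> (\<psi> y) (\<phi> x) z"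
    using xy z
    by (simp add: bihom_associator_def curly rhd cl T_bracket_psi_phi rho_hom)
       (simp add: T_phi T_psi cl)
qed (use VL.carrier_subspace phi_linear psi_linear phi_psi_commute in auto)

lemma T_eq_0_phi_psi_iff:
  assumes "v \<in> V"
  shows "T (\<phi> v) = 0 \<longleftrightarrow> T v = 0" and "T (\<psi> v) = 0 \<longleftrightarrow> T v = 0"
proof -
  have z: "\<alpha> 0 = 0" "\<beta> 0 = 0" "0 \<in> A"
    using linear_on_group_hom(1)[OF carrier_subspace] alpha_linear beta_linear
      subspace_0[OF carrier_subspace] by auto
  show "T (\<phi> v) = 0 \<longleftrightarrow> T v = 0"
    using assms z alpha_bij by (metis T_phi T_closed bij_betw_def inj_onD)
  show "T (\<psi> v) = 0 \<longleftrightarrow> T v = 0"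
    using assms z beta_bij by (metis T_psi T_closed bij_betw_def inj_onD)
qed

text \<open>If \<open>T v = 0\<close> and \<open>v = \<phi> b\<close>, then also \<open>T (\<psi> b) = 0\<close>, since the kernel of \<open>T\<close> is stable under
  the structure maps and their inverses. So the term with \<open>u\<close> and \<open>v\<close> exchanged in
  \<open>T_bracket_psi_phi\<close> vanishes, and so do the bracket of \<open>A\<close> and the image of the weighted bracket of \<open>V\<close>.\<close>

lemma T_rho_eq_0:
  assumes ker: "\<forall>u\<in>V. \<forall>v\<in>V. T v = 0 \<longrightarrow> T (sV wt (brV u v)) = 0"
    and uv: "u \<in> V" "v \<in> V" and "T v = 0"
  shows "T (\<rho> (T u) v) = 0"
proof -
  note cl = VL.carrier_closed T_closed rho_closed carrier_closed
  obtain a b where ab: "a \<in> V" "b \<in> V" "u = \<psi> a" "v = \<phi> b"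
    using bij_betw_ex_preimage[OF psi_bij uv(1)]
      bij_betw_ex_preimage[OF phi_bij uv(2)] by metis
  have b0: "T b = 0" "T (\<psi> b) = 0"
    using \<open>T v = 0\<close> ab T_eq_0_phi_psi_iff by auto
  have "br (T u) 0 = 0" "\<rho> 0 (\<phi> a) = 0"
    using linear_on_group_hom(1)[OF carrier_subspace bilinear_onD(1)[OF bracket_bilinear]]
      linear_on_group_hom(1)[OF carrier_subspace bilinear_onD(2)[OF rho_linear]] uv ab
    by (auto simp: cl)
  moreover have "\<alpha> 0 = 0"
    by (rule linear_on_group_hom(1)[OF carrier_subspace alpha_linear])
  moreover have "T 0 = 0"
    by (rule V.linear_on_group_hom(1)[OF VL.carrier_subspace T_linear])
  ultimately show ?thesis
    using T_bracket_psi_phi[OF ab(1,2)] ker uv b0 ab \<open>T v = 0\<close>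
    by (simp add: T_psi T_phi[symmetric])
qed

text \<open>Skew-symmetry only exchanges arguments of the form \<open>\<psi> a\<close> and \<open>\<phi> b\<close>, which turns \<open>\<psi> a\<close> into \<open>\<phi> a\<close>;
  the stability of the kernel under the structure maps and their inverses bridges this.\<close>

lemma T_bracket_left_eq_0:
  assumes ker: "\<forall>u\<in>V. \<forall>v\<in>V. T v = 0 \<longrightarrow> T (sV wt (brV u v)) = 0"
    and uv: "u \<in> V" "v \<in> V" and "T u = 0"
  shows "T (sV wt (brV u v)) = 0"
proof -
  note cl = VL.carrier_closed T_closed
  obtain a b where ab: "a \<in> V" "b \<in> V" "u = \<psi> a" "v = \<phi> b"
    using bij_betw_ex_preimage[OF psi_bij uv(1)]
      bij_betw_ex_preimage[OF phi_bij uv(2)] by metis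
  have "T (\<phi> a) = 0"
    using \<open>T u = 0\<close> ab T_eq_0_phi_psi_iff by auto
  then have "T (sV wt (brV (\<psi> b) (\<phi> a))) = 0"
    using ker ab by (simp add: cl)
  then show ?thesis
    using ab VL.skew_symmetry[OF ab(1,2)]
      V.linear_on_group_hom(2)[OF VL.carrier_subspace T_linear]
    by (simp add: cl)
qed

end

section \<open>The induced structures on the module and on the image\<close>

theorem theorem3p13:
  fixes sA :: "'k::field_char_0 \<Rightarrow> 'a::ab_group_add \<Rightarrow> 'a"
    and A :: "'a set" and br :: "'a \<Rightarrow> 'a \<Rightarrow> 'a" and \<alpha> \<beta> :: "'a \<Rightarrow> 'a"
    and sV :: "'k \<Rightarrow> 'v::ab_group_add \<Rightarrow> 'v"
    and V :: "'v set" and brV :: "'v \<Rightarrow> 'v \<Rightarrow> 'v"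
    and \<rho> :: "'a \<Rightarrow> 'v \<Rightarrow> 'v" and \<phi> \<psi> :: "'v \<Rightarrow> 'v"
    and wt :: 'k and T :: "'v \<Rightarrow> 'a"
    and curly rhd :: "'v \<Rightarrow> 'v \<Rightarrow> 'v"
  assumes "regular_bihom_lie_algebra sA A br \<alpha> \<beta>"
    and "regular_bihom_module_algebra sA A br \<alpha> \<beta> sV V brV \<rho> \<phi> \<psi>"
    and "o_operator sA A br \<alpha> \<beta> sV V brV \<rho> \<phi> \<psi> wt T"
    and curly: "\<And>u v. u \<in> V \<Longrightarrow> v \<in> V \<Longrightarrow> curly u v = sV wt (brV u v)"
    and rhd: "\<And>u v. u \<in> V \<Longrightarrow> v \<in> V \<Longrightarrow> rhd u v = \<rho> (T u) v"
  shows "bihom_post_lie_algebra sV V curly rhd \<phi> \<psi>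
    \<and> bihom_lie_morphism sV V (subadjacent_bracket V curly rhd \<phi> \<psi>) \<phi> \<psi> sA A br \<alpha> \<beta> T
    \<and> bihom_lie_subalgebra sA A br \<alpha> \<beta> (T ` V)
    \<and> ((\<forall>u\<in>V. \<forall>v\<in>V. T v = 0 \<longrightarrow> T (curly u v) = 0) \<longrightarrow>
        (\<exists>brT rhdT. bihom_post_lie_algebra sA (T ` V) brT rhdT \<alpha> \<beta>
          \<and> (\<forall>u\<in>V. \<forall>v\<in>V. brT (T u) (T v) = T (curly u v))
          \<and> (\<forall>u\<in>V. \<forall>v\<in>V. rhdT (T u) (T v) = T (rhd u v))))"
proof (intro conjI impI)
  interpret o_operator sA A br \<alpha> \<beta> sV V brV \<rho> \<phi> \<psi> wt T by fact
  show post: "bihom_post_lie_algebra sV V curly rhd \<phi> \<psi>"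
    by (rule induced_bihom_post_lie_algebra[OF curly rhd])
  interpret P: bihom_post_lie_algebra sV V curly rhd \<phi> \<psi> by (rule post)
  let ?S = "subadjacent_bracket V curly rhd \<phi> \<psi>"
  have sub: "bihom_lie_algebra sV V ?S \<phi> \<psi>"
    by (rule P.subadjacent_bihom_lie_algebra[OF phi_bij psi_bij])
  interpret S: bihom_lie_algebra sV V ?S \<phi> \<psi> by (rule sub)
  have T_S: "T (?S u v) = br (T u) (T v)" if "u \<in> V" "v \<in> V" for u v
  proof -
    have "inv_into V \<phi> (\<psi> v) \<in> V" "\<phi> (inv_into V \<psi> u) \<in> V"
      using that phi_bij psi_bij
      by (auto simp: bij_betw_def VL.carrier_closed intro!: VL.carrier_closed(5) inv_into_into)
    then show ?thesis
      using that by (simp add: subadjacent_bracket_def T_bracket curly rhd)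
  qed
  have lie: "bihom_lie_algebra sA A br \<alpha> \<beta>" by unfold_locales
  show "bihom_lie_morphism sV V ?S \<phi> \<psi> sA A br \<alpha> \<beta> T"
    unfolding bihom_lie_morphism_def using sub lie T_linear T_S T_phi T_psi by blast
  have "br (T u) (T v) \<in> T ` V" if "u \<in> V" "v \<in> V" for u v
    using T_S[OF that] S.carrier_closed(7)[OF that] by (metis imageI)
  moreover have "\<alpha> (T u) \<in> T ` V" "\<beta> (T u) \<in> T ` V" if "u \<in> V" for u
    using that VL.carrier_closed(5,6) by (auto simp: T_phi[symmetric] T_psi[symmetric])
  moreover have "subspace (T ` V)"
    by (rule V.subspace_linear_on_image[OF VL.carrier_subspace vector_space_axioms T_linear])
  ultimately show "bihom_lie_subalgebra sA A br \<alpha> \<beta> (T ` V)"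
    unfolding bihom_lie_subalgebra_def using lie T_closed by blast
  assume ker: "\<forall>u\<in>V. \<forall>v\<in>V. T v = 0 \<longrightarrow> T (curly u v) = 0"
  have ker': "\<forall>u\<in>V. \<forall>v\<in>V. T v = 0 \<longrightarrow> T (sV wt (brV u v)) = 0"
    using ker by (simp add: curly)
  define brT where "brT = (\<lambda>p q. T (curly (inv_into V T p) (inv_into V T q)))"
  define rhdT where "rhdT = (\<lambda>p q. T (rhd (inv_into V T p) (inv_into V T q)))"
  note descends = V.bilinear_on_descends[OF VL.carrier_subspace T_linear]
  have brT: "brT (T u) (T v) = T (curly u v)" if "u \<in> V" "v \<in> V" for u v
    unfolding brT_def
    by (rule descends[OF P.bracket_bilinear _ _ that])
      (simp_all add: ker' T_bracket_left_eq_0[OF ker'] curly)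
  have rho0: "\<rho> 0 v = 0" if "v \<in> V" for v
    by (rule linear_on_group_hom(1)[OF carrier_subspace bilinear_onD(2)[OF rho_linear that]])
  have T0: "T 0 = 0"
    by (rule V.linear_on_group_hom(1)[OF VL.carrier_subspace T_linear])
  have rhdT: "rhdT (T u) (T v) = T (rhd u v)" if "u \<in> V" "v \<in> V" for u v
    unfolding rhdT_def
    by (rule descends[OF P.rhd_bilinear _ _ that])
      (simp_all add: T_rho_eq_0[OF ker'] rhd rho0 T0)
  have "bihom_post_lie_algebra sA (T ` V) brT rhdT \<alpha> \<beta>"
    by (rule P.bihom_post_lie_algebra_image[OF vector_space_axioms T_linear])
      (simp_all add: T_phi T_psi brT rhdT)
  then show "\<exists>brT rhdT. bihom_post_lie_algebra sA (T ` V) brT rhdT \<alpha> \<beta>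
          \<and> (\<forall>u\<in>V. \<forall>v\<in>V. brT (T u) (T v) = T (curly u v))
          \<and> (\<forall>u\<in>V. \<forall>v\<in>V. rhdT (T u) (T v) = T (rhd u v))"
    by (intro exI[of _ brT] exI[of _ rhdT]) (simp add: brT rhdT)
qed

end
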